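(* Let $\ell^{n}=\{M,H\}$ be a Cartan space with $(\alpha,\beta)$-metric, considered on the region $U\subset T^{*}M\setminus\{0\}$, whose invariants are $$\rho_{1}=\frac{2\beta^{3}-3\alpha\beta^{2}}{2(\beta-\alpha)^{2}},\quad \rho=\frac{\beta^{3}}{2\alpha(\beta-\alpha)^{2}},\quad \rho_{0}=\frac{\beta^{3}-3\alpha\beta^{2}+3\alpha^{2}\beta}{(\beta-\alpha)^{3}},\quad \rho_{-1}=\frac{\beta^{3}-3\alpha\beta^{2}}{2\alpha(\beta-\alpha)^{3}},\quad \rho_{-2}=\frac{\beta^{3}(3\alpha-\beta)}{2\alpha^{3}(\beta-\alpha)^{3}},$$ $$r_{-1}=\frac{-3\alpha^{3}}{(\beta-\alpha)^{4}},\quad r_{-2}=\frac{3\alpha\beta}{(\beta-\alpha)^{4}},\quad r_{-3}=\frac{4\alpha\beta^{3}-\beta^{4}-9\alpha^{2}\beta^{2}}{2\alpha^{3}(\beta-\alpha)^{4}},\quad r_{-4}=\frac{15\alpha^{2}\beta^{3}+3\beta^{5}-12\alpha\beta^{4}}{2\alpha^{5}(\beta-\alpha)^{4}}.$$ Then $\ell^{n}$ is the Cartan space with fundamental function $H(\alpha,\beta)=\dfrac{\beta^{3}}{\beta-\alpha}$ on $U$.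
   Context: $M$ is an $n$-dimensional smooth manifold, $(x,y)=(x^i,y_i)$ are the canonical coordinates on $T^{*}M$, and summation over repeated indices is understood. $a^{ij}(x)$ is a (contravariant) Riemannian metric on $M$, $b^{i}(x)$ a vector field on $M$, and $\alpha(x,y)=\sqrt{a^{ij}(x)y_iy_j}$, $\beta(x,y)=b^{i}(x)y_i$. $U$ denotes the region of $T^{*}M\setminus\{0\}$ (zero section removed) where $\beta>0$ and $\alpha<\beta$. A Cartan space $\ell^{n}=\{M,H(x,y)\}$ is given by a fundamental function $H(x,y)$ positively homogeneous of degree $2$ in $y$ whose fundamental tensor $g^{ij}=\frac12\frac{\partial^2 H}{\partial y_i\partial y_j}$ is nondegenerate. It is a Cartan space with $(\alpha,\beta)$-metric if $H(x,y)=H(\alpha(x,y),\beta(x,y))$ is a (smooth) function of $\alpha$ and $\beta$ only; the function $H(\alpha,\beta)$ is then positively homogeneous of degree $2$ in $(\alpha,\beta)$. Subscripts on $H$ denote partial derivatives of $H(\alpha,\beta)$. The invariants of a Cartan space with $(\alpha,\beta)$-metric are $$\rho_{1}=\tfrac12H_{\beta},\quad \rho=\tfrac{1}{2\alpha}H_{\alpha},\quad \rho_{0}=\tfrac12H_{\beta\beta},\quad \rho_{-1}=\tfrac{1}{2\alpha}H_{\alpha\beta},\quad \rho_{-2}=\tfrac{1}{2\alpha^{2}}\left(H_{\alpha\alpha}-\alpha^{-1}H_{\alpha}\right),$$ $$r_{-1}=\tfrac12H_{\beta\beta\beta},\quad r_{-2}=\tfrac{1}{2\alpha}H_{\alpha\beta\beta},\quad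 r_{-3}=\tfrac{1}{2\alpha^{2}}\left(H_{\alpha\alpha\beta}-\alpha^{-1}H_{\alpha\beta}\right),\quad r_{-4}=\tfrac{1}{2\alpha^{3}}\left(H_{\alpha\alpha\alpha}-3\alpha^{-1}H_{\alpha\alpha}+3\alpha^{-2}H_{\alpha}\right).$$ *)

theory Defs
  imports "HOL-Analysis.Analysis"
begin

section \<open>Smooth maps between Euclidean spaces\<close>

text \<open>\<open>frechet_derivative f (at x)\<close> is a genuine two-sided derivative, so these notions are meant for
  \<^emph>\<open>open\<close> sets \<open>S\<close> only.\<close>

primrec Ck_on :: "nat \<Rightarrow> 'a::real_normed_vector set \<Rightarrow> ('a \<Rightarrow> 'b::real_normed_vector) \<Rightarrow> bool" where
  "Ck_on 0 S f \<longleftrightarrow> continuous_on S f"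
| "Ck_on (Suc k) S f \<longleftrightarrow>
     (\<forall>x\<in>S. f differentiable (at x)) \<and> (\<forall>v. Ck_on k S (\<lambda>x. frechet_derivative f (at x) v))"

definition smooth_on :: "'a::real_normed_vector set \<Rightarrow> ('a \<Rightarrow> 'b::real_normed_vector) \<Rightarrow> bool" where
  "smooth_on S f \<longleftrightarrow> (\<forall>k. Ck_on k S f)"


section \<open>Smooth manifolds\<close>

text \<open>A chart is a pair \<open>(D, \<phi>)\<close> of its domain and its coordinate map. The dimension \<open>n\<close> of the
  manifold is \<open>CARD('n)\<close>.\<close>

type_synonym ('m, 'n) chart = "'m set \<times> ('m \<Rightarrow> real^'n)"

definition chart_inv :: "('m, 'n::finite) chart \<Rightarrow> real^'n \<Rightarrow> 'm" where
  "chart_inv c = inv_into (fst c) (snd c)"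

definition transition :: "('m, 'n::finite) chart \<Rightarrow> ('m, 'n) chart \<Rightarrow> real^'n \<Rightarrow> real^'n" where
  "transition c d = snd d \<circ> chart_inv c"

definition smooth_manifold :: "'m topology \<Rightarrow> ('m, 'n::finite) chart set \<Rightarrow> bool" where
  "smooth_manifold M A \<longleftrightarrow>
     Hausdorff_space M \<and> second_countable M \<and>
     (\<Union>c\<in>A. fst c) = topspace M \<and>
     (\<forall>(D, \<phi>)\<in>A. openin M D \<and> open (\<phi> ` D) \<and>
        homeomorphic_map (subtopology M D) (top_of_set (\<phi> ` D)) \<phi>) \<and>
     (\<forall>c\<in>A. \<forall>d\<in>A. smooth_on (snd c ` (fst c \<inter> fst d)) (transition c d))"

text \<open>The Jacobian matrix of the change of coordinates from \<open>c\<close> to \<open>d\<close> at the point \<open>p\<close>: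
  \<open>jac c d p $ k $ i\<close> is the derivative of the \<open>k\<close>-th coordinate of \<open>d\<close> with respect to the
  \<open>i\<close>-th coordinate of \<open>c\<close>.\<close>

definition jac :: "('m, 'n::finite) chart \<Rightarrow> ('m, 'n) chart \<Rightarrow> 'm \<Rightarrow> real^'n^'n" where
  "jac c d p = matrix (frechet_derivative (transition c d) (at (snd c p)))"


section \<open>Tensor fields and the cotangent bundle\<close>

text \<open>Tensors at a point \<open>p\<close> are given by their components in all charts around \<open>p\<close>, related by the
  usual transformation laws. \<open>b p c $ i\<close> is the component \<open>b\<^sup>i\<close> at \<open>p\<close> in the chart \<open>c\<close>, and
  \<open>a p c $ i $ j\<close> the component \<open>a\<^sup>i\<^sup>j\<close>.\<close>

definition vector_field ::
  "('m, 'n::finite) chart set \<Rightarrow> ('m \<Rightarrow> ('m, 'n) chart \<Rightarrow> real^'n) \<Rightarrow> bool" where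
  "vector_field A b \<longleftrightarrow>
     (\<forall>c\<in>A. \<forall>d\<in>A. \<forall>p\<in>fst c \<inter> fst d. b p d = jac c d p *v b p c) \<and>
     (\<forall>c\<in>A. smooth_on (snd c ` fst c) (\<lambda>x. b (chart_inv c x) c))"

definition riemannian_cometric ::
  "('m, 'n::finite) chart set \<Rightarrow> ('m \<Rightarrow> ('m, 'n) chart \<Rightarrow> real^'n^'n) \<Rightarrow> bool" where
  "riemannian_cometric A a \<longleftrightarrow>
     (\<forall>c\<in>A. \<forall>d\<in>A. \<forall>p\<in>fst c \<inter> fst d. a p d = jac c d p ** a p c ** transpose (jac c d p)) \<and>
     (\<forall>c\<in>A. smooth_on (snd c ` fst c) (\<lambda>x. a (chart_inv c x) c)) \<and>
     (\<forall>c\<in>A. \<forall>p\<in>fst c. transpose (a p c) = a p c \<and> (\<forall>y. y \<noteq> 0 \<longrightarrow> 0 < y \<bullet> (a p c *v y)))"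

text \<open>A covector at \<open>p\<close> is the family \<open>w\<close> of its component vectors \<open>w c = (y\<^sub>i)\<close>, with \<open>w c = 0\<close>
  by convention if \<open>c\<close> is not a chart around \<open>p\<close>.\<close>

type_synonym ('m, 'n) covector = "('m, 'n) chart \<Rightarrow> real^'n"

definition cotangent_space :: "('m, 'n::finite) chart set \<Rightarrow> 'm \<Rightarrow> ('m, 'n) covector set" where
  "cotangent_space A p =
     {w. (\<forall>c\<in>A. \<forall>d\<in>A. p \<in> fst c \<inter> fst d \<longrightarrow> w c = transpose (jac c d p) *v w d) \<and>
         (\<forall>c. \<not> (c \<in> A \<and> p \<in> fst c) \<longrightarrow> w c = 0)}"

definition slit_cotangent_bundle ::
  "'m topology \<Rightarrow> ('m, 'n::finite) chart set \<Rightarrow> ('m \<times> ('m, 'n) covector) set" where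
  "slit_cotangent_bundle M A =
     {(p, w). p \<in> topspace M \<and> w \<in> cotangent_space A p \<and> w \<noteq> (\<lambda>_. 0)}"

text \<open>The covector at \<open>p\<close> with components \<open>y\<close> in the chart \<open>c\<close>, and the point of the cotangent
  bundle with canonical coordinates \<open>(x, y)\<close> induced by \<open>c\<close>.\<close>

definition covector_of ::
  "('m, 'n::finite) chart set \<Rightarrow> ('m, 'n) chart \<Rightarrow> 'm \<Rightarrow> real^'n \<Rightarrow> ('m, 'n) covector" where
  "covector_of A c p y = (\<lambda>d. if d \<in> A \<and> p \<in> fst d then transpose (jac d c p) *v y else 0)"

definition canonical_point ::
  "('m, 'n::finite) chart set \<Rightarrow> ('m, 'n) chart \<Rightarrow> (real^'n) \<times> (real^'n) \<Rightarrow> 'm \<times> ('m, 'n) covector" where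
  "canonical_point A c = (\<lambda>(x, y). (chart_inv c x, covector_of A c (chart_inv c x) y))"


section \<open>The functions \<open>\<alpha>\<close> and \<open>\<beta>\<close> and the region \<open>U\<close>\<close>

definition chart_at :: "('m, 'n::finite) chart set \<Rightarrow> 'm \<Rightarrow> ('m, 'n) chart" where
  "chart_at A p = (SOME c. c \<in> A \<and> p \<in> fst c)"

text \<open>By the transformation laws the values below do not depend on the chosen chart, see
  \<open>alpha_eq\<close> and \<open>beta_eq\<close>.\<close>

definition alpha :: "('m, 'n::finite) chart set \<Rightarrow> ('m \<Rightarrow> ('m, 'n) chart \<Rightarrow> real^'n^'n) \<Rightarrow>
    'm \<times> ('m, 'n) covector \<Rightarrow> real" where
  "alpha A a = (\<lambda>(p, w). let c = chart_at A p in
     sqrt (\<Sum>i\<in>UNIV. \<Sum>j\<in>UNIV. a p c $ i $ j * w c $ i * w c $ j))"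

definition beta :: "('m, 'n::finite) chart set \<Rightarrow> ('m \<Rightarrow> ('m, 'n) chart \<Rightarrow> real^'n) \<Rightarrow>
    'm \<times> ('m, 'n) covector \<Rightarrow> real" where
  "beta A b = (\<lambda>(p, w). let c = chart_at A p in \<Sum>i\<in>UNIV. b p c $ i * w c $ i)"

definition region_U :: "'m topology \<Rightarrow> ('m, 'n::finite) chart set \<Rightarrow>
    ('m \<Rightarrow> ('m, 'n) chart \<Rightarrow> real^'n^'n) \<Rightarrow> ('m \<Rightarrow> ('m, 'n) chart \<Rightarrow> real^'n) \<Rightarrow>
    ('m \<times> ('m, 'n) covector) set" where
  "region_U M A a b =
     {z \<in> slit_cotangent_bundle M A. 0 < beta A b z \<and> alpha A a z < beta A b z}"

lemma sum_bilinear_form: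
  fixes B :: "real^'n^'n"
  shows "(\<Sum>i\<in>UNIV. \<Sum>j\<in>UNIV. B $ i $ j * y $ i * y $ j) = y \<bullet> (B *v y)"
  by (simp add: inner_vec_def matrix_vector_mult_def sum_distrib_left mult_ac)

lemma chart_at_in:
  assumes "c \<in> A" "p \<in> fst c"
  shows "chart_at A p \<in> A" "p \<in> fst (chart_at A p)"
  using someI[of "\<lambda>c. c \<in> A \<and> p \<in> fst c", OF conjI[OF assms]] by (auto simp: chart_at_def)

lemma alpha_eq:
  assumes a: "riemannian_cometric A a" and w: "w \<in> cotangent_space A p" and c: "c \<in> A" "p \<in> fst c"
  shows "alpha A a (p, w) = sqrt (\<Sum>i\<in>UNIV. \<Sum>j\<in>UNIV. a p c $ i $ j * w c $ i * w c $ j)"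
proof -
  let ?d = "chart_at A p"
  let ?J = "jac c ?d p"
  have d: "?d \<in> A" "p \<in> fst ?d" using chart_at_in[OF c] by auto
  have 1: "a p ?d = ?J ** a p c ** transpose ?J"
    using a c d unfolding riemannian_cometric_def by blast
  have 2: "w c = transpose ?J *v w ?d"
    using w c d unfolding cotangent_space_def by blast
  have "w ?d \<bullet> (a p ?d *v w ?d) = w c \<bullet> (a p c *v w c)"
    unfolding 1 2 by (simp add: dot_lmul_matrix vector_transpose_matrix
        matrix_vector_mul_assoc[symmetric] flip: transpose_matrix_vector)
      (simp add: dot_lmul_matrix transpose_matrix_vector)
  then show ?thesis by (simp add: alpha_def Let_def sum_bilinear_form)
qed

lemma beta_eq:
  assumes b: "vector_field A b" and w: "w \<in> cotangent_space A p" and c: "c \<in> A" "p \<in> fst c"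
  shows "beta A b (p, w) = (\<Sum>i\<in>UNIV. b p c $ i * w c $ i)"
proof -
  let ?d = "chart_at A p"
  let ?J = "jac c ?d p"
  have d: "?d \<in> A" "p \<in> fst ?d" using chart_at_in[OF c] by auto
  have 1: "b p ?d = ?J *v b p c"
    using b c d unfolding vector_field_def by blast
  have 2: "w c = transpose ?J *v w ?d"
    using w c d unfolding cotangent_space_def by blast
  have "w ?d \<bullet> b p ?d = w c \<bullet> b p c"
    unfolding 1 2 by (simp add: dot_lmul_matrix transpose_matrix_vector)
  then show ?thesis by (simp add: beta_def Let_def inner_vec_def mult.commute)
qed


section \<open>Cartan spaces\<close>

definition partial :: "'n::finite \<Rightarrow> (real^'n \<Rightarrow> real) \<Rightarrow> real^'n \<Rightarrow> real" where
  "partial i f y = deriv (\<lambda>t. f (y + t *\<^sub>R axis i 1)) 0"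

text \<open>The components of the fundamental tensor in the chart \<open>c\<close> at the covector at \<open>p\<close> with
  components \<open>y\<close>.\<close>

definition fundamental_tensor :: "('m, 'n::finite) chart set \<Rightarrow> ('m \<times> ('m, 'n) covector \<Rightarrow> real) \<Rightarrow>
    ('m, 'n) chart \<Rightarrow> 'm \<Rightarrow> real^'n \<Rightarrow> real^'n^'n" where
  "fundamental_tensor A H c p y =
     (\<chi> i j. 1/2 * partial i (partial j (\<lambda>y. H (p, covector_of A c p y))) y)"

text \<open>Only the values of \<open>H\<close> on the open conic part \<open>U\<close> of the slit cotangent bundle are
  meaningful.\<close>

definition cartan_space_on :: "('m, 'n::finite) chart set \<Rightarrow> ('m \<times> ('m, 'n) covector) set \<Rightarrow>
    ('m \<times> ('m, 'n) covector \<Rightarrow> real) \<Rightarrow> bool" where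
  "cartan_space_on A U H \<longleftrightarrow>
     (\<forall>c\<in>A. smooth_on {(x, y). x \<in> snd c ` fst c \<and> canonical_point A c (x, y) \<in> U}
                      (\<lambda>z. H (canonical_point A c z))) \<and>
     (\<forall>(p, w)\<in>U. \<forall>r>0. H (p, \<lambda>c. r *\<^sub>R w c) = r\<^sup>2 * H (p, w)) \<and>
     (\<forall>(p, w)\<in>U. \<forall>c\<in>A. p \<in> fst c \<longrightarrow> invertible (fundamental_tensor A H c p (w c)))"

text \<open>\<open>H\<close> is on \<open>U\<close> the function \<open>h(\<alpha>, \<beta>)\<close>, with \<open>h\<close> smooth on a neighbourhood of all values
  of \<open>(\<alpha>, \<beta>)\<close>.\<close>

definition alpha_beta_metric_on :: "('m, 'n::finite) chart set \<Rightarrow> ('m \<times> ('m, 'n) covector) set \<Rightarrow>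
    ('m \<Rightarrow> ('m, 'n) chart \<Rightarrow> real^'n^'n) \<Rightarrow> ('m \<Rightarrow> ('m, 'n) chart \<Rightarrow> real^'n) \<Rightarrow>
    ('m \<times> ('m, 'n) covector \<Rightarrow> real) \<Rightarrow> (real \<Rightarrow> real \<Rightarrow> real) \<Rightarrow> bool" where
  "alpha_beta_metric_on A U a b H h \<longleftrightarrow>
     (\<forall>z\<in>U. H z = h (alpha A a z) (beta A b z)) \<and>
     (\<exists>\<Omega>. open \<Omega> \<and> (\<lambda>z. (alpha A a z, beta A b z)) ` U \<subseteq> \<Omega> \<and> smooth_on \<Omega> (\<lambda>(s, t). h s t))"


section \<open>The invariants\<close>

text \<open>Below \<open>s\<close> stands for \<open>\<alpha>\<close> and \<open>t\<close> for \<open>\<beta>\<close>.\<close>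

definition d\<alpha> :: "(real \<Rightarrow> real \<Rightarrow> real) \<Rightarrow> real \<Rightarrow> real \<Rightarrow> real" where
  "d\<alpha> h s t = deriv (\<lambda>s. h s t) s"

definition d\<beta> :: "(real \<Rightarrow> real \<Rightarrow> real) \<Rightarrow> real \<Rightarrow> real \<Rightarrow> real" where
  "d\<beta> h s t = deriv (\<lambda>t. h s t) t"

definition rho1 :: "(real \<Rightarrow> real \<Rightarrow> real) \<Rightarrow> real \<Rightarrow> real \<Rightarrow> real" where
  "rho1 h s t = 1/2 * d\<beta> h s t"

definition rho :: "(real \<Rightarrow> real \<Rightarrow> real) \<Rightarrow> real \<Rightarrow> real \<Rightarrow> real" where
  "rho h s t = 1/(2 * s) * d\<alpha> h s t"

definition rho0 :: "(real \<Rightarrow> real \<Rightarrow> real) \<Rightarrow> real \<Rightarrow> real \<Rightarrow> real" where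
  "rho0 h s t = 1/2 * d\<beta> (d\<beta> h) s t"

definition rho_m1 :: "(real \<Rightarrow> real \<Rightarrow> real) \<Rightarrow> real \<Rightarrow> real \<Rightarrow> real" where
  "rho_m1 h s t = 1/(2 * s) * d\<beta> (d\<alpha> h) s t"

definition rho_m2 :: "(real \<Rightarrow> real \<Rightarrow> real) \<Rightarrow> real \<Rightarrow> real \<Rightarrow> real" where
  "rho_m2 h s t = 1/(2 * s^2) * (d\<alpha> (d\<alpha> h) s t - 1/s * d\<alpha> h s t)"

definition r_m1 :: "(real \<Rightarrow> real \<Rightarrow> real) \<Rightarrow> real \<Rightarrow> real \<Rightarrow> real" where
  "r_m1 h s t = 1/2 * d\<beta> (d\<beta> (d\<beta> h)) s t"

definition r_m2 :: "(real \<Rightarrow> real \<Rightarrow> real) \<Rightarrow> real \<Rightarrow> real \<Rightarrow> real" where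
  "r_m2 h s t = 1/(2 * s) * d\<beta> (d\<beta> (d\<alpha> h)) s t"

definition r_m3 :: "(real \<Rightarrow> real \<Rightarrow> real) \<Rightarrow> real \<Rightarrow> real \<Rightarrow> real" where
  "r_m3 h s t = 1/(2 * s^2) * (d\<beta> (d\<alpha> (d\<alpha> h)) s t - 1/s * d\<beta> (d\<alpha> h) s t)"

definition r_m4 :: "(real \<Rightarrow> real \<Rightarrow> real) \<Rightarrow> real \<Rightarrow> real \<Rightarrow> real" where
  "r_m4 h s t = 1/(2 * s^3) * (d\<alpha> (d\<alpha> (d\<alpha> h)) s t - 3/s * d\<alpha> (d\<alpha> h) s t + 3/s^2 * d\<alpha> h s t)"

end

(* Euler's identity for the 2-homogeneous function h reads 2 h = alpha h_alpha + beta h_beta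
   = 2 alpha^2 rho + 2 beta rho_1, so rho and rho_1 alone already determine h:
   the right-hand side is 2 beta^3 / (beta - alpha). *)

theory Submission
  imports Defs
begin

text \<open>Restricting the total derivative to the two coordinate lines, by the chain rule, links
  the one-variable \<open>deriv\<close> in \<open>d\<alpha>\<close> and \<open>d\<beta>\<close> to
  the linear map \<open>F\<close>.\<close>

lemma differentiable_partials:
  fixes h :: "real \<Rightarrow> real \<Rightarrow> real"
  assumes F: "((\<lambda>(s, t). h s t) has_derivative F) (at (s, t))"
  shows "d\<alpha> h s t = F (1, 0)" "d\<beta> h s t = F (0, 1)"
proof -
  interpret linear F using F by (rule has_derivative_linear)
  have "((\<lambda>u. (\<lambda>(s, t). h s t) (u, t)) has_derivative (\<lambda>u. F (u, 0))) (at s)"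
    by (rule has_derivative_compose[where g = "\<lambda>(s, t). h s t"])
      (auto intro!: derivative_eq_intros F)
  \<comment> \<open>A linear map of the real line is multiplication by its value at 1; in this form
    the derivative is a field derivative, which determines \<open>deriv\<close>.\<close>
  moreover have "(\<lambda>u. F (u, 0)) = (*) (F (1, 0))"
  proof
    show "F (u, 0) = F (1, 0) * u" for u
      using scaleR[of u "(1, 0)"] by simp
  qed
  ultimately show "d\<alpha> h s t = F (1, 0)"
    by (auto simp: d\<alpha>_def has_field_derivative_def intro!: DERIV_imp_deriv)
  have "((\<lambda>u. (\<lambda>(s, t). h s t) (s, u)) has_derivative (\<lambda>u. F (0, u))) (at t)"
    by (rule has_derivative_compose[where g = "\<lambda>(s, t). h s t"])
      (auto intro!: derivative_eq_intros F)
  moreover have "(\<lambda>u. F (0, u)) = (*) (F (0, 1))"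
  proof
    show "F (0, u) = F (0, 1) * u" for u
      using scaleR[of u "(0, 1)"] by simp
  qed
  ultimately show "d\<beta> h s t = F (0, 1)"
    by (auto simp: d\<beta>_def has_field_derivative_def intro!: DERIV_imp_deriv)
qed

text \<open>Differentiate \<open>h (r * s) (r * t)\<close> in \<open>r\<close> at 1 in two ways: by
  the chain rule and by homogeneity. Everything is assumed at one point and along its ray only, so
  nothing about the shape of the set of values of (\<alpha>, \<beta>) enters.\<close>

lemma euler_homogeneous:
  fixes h :: "real \<Rightarrow> real \<Rightarrow> real"
  assumes diff: "(\<lambda>(s, t). h s t) differentiable (at (s, t))"
    and hom: "\<And>r. r > 0 \<Longrightarrow> h (r * s) (r * t) = r ^ k * h s t"
  shows "s * d\<alpha> h s t + t * d\<beta> h s t = real k * h s t"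
proof -
  obtain F where F: "((\<lambda>(s, t). h s t) has_derivative F) (at (s, t))"
    using diff by (auto simp: differentiable_def)
  interpret linear F using F by (rule has_derivative_linear)
  have "((\<lambda>r. (\<lambda>(s, t). h s t) (r * s, r * t)) has_derivative (\<lambda>r. F (r * s, r * t))) (at 1)"
    by (rule has_derivative_compose[where g = "\<lambda>(s, t). h s t"])
      (auto intro!: derivative_eq_intros F)
  moreover have "(\<lambda>r. F (r * s, r * t)) = (*) (F (s, t))"
    using scaleR[of _ "(s, t)"] by (auto simp: mult.commute)
  ultimately have "((\<lambda>r. h (r * s) (r * t)) has_field_derivative F (s, t)) (at 1)"
    by (simp add: has_field_derivative_def)
  \<comment> \<open>Homogeneity holds only for positive \<open>r\<close>, so the two functions are
    exchanged on an open neighbourhood of 1.\<close>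
  then have "((\<lambda>r. r ^ k * h s t) has_field_derivative F (s, t)) (at 1)"
    by (rule has_field_derivative_transform_within_open[where S = "{0<..}"]) (auto simp: hom)
  moreover have "((\<lambda>r. r ^ k * h s t) has_field_derivative real k * h s t) (at 1)"
    by (auto intro!: derivative_eq_intros)
  ultimately have "F (s, t) = real k * h s t"
    by (rule DERIV_unique)
  moreover have "F (s, t) = s * F (1, 0) + t * F (0, 1)"
    using add[of "(s, 0)" "(0, t)"] scaleR[of s "(1, 0)"] scaleR[of t "(0, 1)"] by simp
  ultimately show ?thesis
    by (simp add: differentiable_partials[OF F])
qed

lemma smooth_on_imp_differentiable:
  assumes "smooth_on S f" "x \<in> S"
  shows "f differentiable (at x)"
proof -
  have "Ck_on (Suc 0) S f" using assms(1) unfolding smooth_on_def by blast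
  then show ?thesis using assms(2) by simp
qed

text \<open>The quadratic form scales by the square of \<open>r\<close>, and the root of that square
  is \<open>r\<close> because \<open>r\<close> is nonnegative. Both sides use the same chart, since
  \<open>chart_at\<close> depends on the base point alone.\<close>

lemma alpha_scaleR:
  fixes A :: "('m, 'n::finite) chart set"
  assumes "r \<ge> 0"
  shows "alpha A a (p, \<lambda>c. r *\<^sub>R w c) = r * alpha A a (p, w)"
proof -
  have "(r *\<^sub>R y) \<bullet> (B *v (r *\<^sub>R y)) = r\<^sup>2 * (y \<bullet> (B *v y))" for B :: "real^'n^'n" and y
    by (simp add: matrix_vector_mult_scaleR power2_eq_square)
  then show ?thesis
    using assms by (simp add: alpha_def Let_def sum_bilinear_form real_sqrt_mult
        del: vector_scaleR_component)
qed

lemma beta_scaleR: "beta A b (p, \<lambda>c. r *\<^sub>R w c) = r * beta A b (p, w)"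
  by (simp add: beta_def Let_def sum_distrib_left mult_ac)

lemma cotangent_space_scaleR:
  assumes "w \<in> cotangent_space A p"
  shows "(\<lambda>c. r *\<^sub>R w c) \<in> cotangent_space A p"
  using assms unfolding cotangent_space_def mem_Collect_eq
  by (metis matrix_vector_mult_scaleR scaleR_zero_right)

text \<open>\<alpha> and \<beta> scale by the same positive factor, which preserves both
  inequalities. That the region is conic lets the homogeneity of \<open>H\<close> pass to
  \<open>h\<close>.\<close>

lemma region_U_scaleR:
  assumes "(p, w) \<in> region_U M A a b" "r > 0"
  shows "(p, \<lambda>c. r *\<^sub>R w c) \<in> region_U M A a b"
  using assms
  by (auto simp: region_U_def slit_cotangent_bundle_def cotangent_space_scaleR
      alpha_scaleR beta_scaleR fun_eq_iff)

theorem theorem5p4: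
  fixes M :: "'m topology"
    and A :: "('m, 'n::finite) chart set"
    and a :: "'m \<Rightarrow> ('m, 'n) chart \<Rightarrow> real^'n^'n"
    and b :: "'m \<Rightarrow> ('m, 'n) chart \<Rightarrow> real^'n"
    and H :: "'m \<times> ('m, 'n) covector \<Rightarrow> real"
    and h :: "real \<Rightarrow> real \<Rightarrow> real"
  assumes "smooth_manifold M A"
    and "riemannian_cometric A a"
    and "vector_field A b"
    and "cartan_space_on A (region_U M A a b) H"
    and "alpha_beta_metric_on A (region_U M A a b) a b H h"
    and "\<And>z \<alpha> \<beta>. \<lbrakk>z \<in> region_U M A a b; \<alpha> = alpha A a z; \<beta> = beta A b z\<rbrakk> \<Longrightarrow>
           rho1 h \<alpha> \<beta> = (2*\<beta>^3 - 3*\<alpha>*\<beta>^2) / (2*(\<beta> - \<alpha>)^2) \<and>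
           rho h \<alpha> \<beta> = \<beta>^3 / (2*\<alpha>*(\<beta> - \<alpha>)^2) \<and>
           rho0 h \<alpha> \<beta> = (\<beta>^3 - 3*\<alpha>*\<beta>^2 + 3*\<alpha>^2*\<beta>) / (\<beta> - \<alpha>)^3 \<and>
           rho_m1 h \<alpha> \<beta> = (\<beta>^3 - 3*\<alpha>*\<beta>^2) / (2*\<alpha>*(\<beta> - \<alpha>)^3) \<and>
           rho_m2 h \<alpha> \<beta> = \<beta>^3*(3*\<alpha> - \<beta>) / (2*\<alpha>^3*(\<beta> - \<alpha>)^3) \<and>
           r_m1 h \<alpha> \<beta> = - 3*\<alpha>^3 / (\<beta> - \<alpha>)^4 \<and>
           r_m2 h \<alpha> \<beta> = 3*\<alpha>*\<beta> / (\<beta> - \<alpha>)^4 \<and>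
           r_m3 h \<alpha> \<beta> = (4*\<alpha>*\<beta>^3 - \<beta>^4 - 9*\<alpha>^2*\<beta>^2) / (2*\<alpha>^3*(\<beta> - \<alpha>)^4) \<and>
           r_m4 h \<alpha> \<beta> = (15*\<alpha>^2*\<beta>^3 + 3*\<beta>^5 - 12*\<alpha>*\<beta>^4) / (2*\<alpha>^5*(\<beta> - \<alpha>)^4)"
  shows "\<forall>z\<in>region_U M A a b. H z = (beta A b z)^3 / (beta A b z - alpha A a z)"
proof
  fix z assume z: "z \<in> region_U M A a b"
  obtain p w where zpw: "z = (p, w)" by (cases z)
  define s t where "s = alpha A a z" and "t = beta A b z"
  have st: "s < t" "0 < t"
    using z by (auto simp: region_U_def s_def t_def)
  have Hh: "H z' = h (alpha A a z') (beta A b z')" if "z' \<in> region_U M A a b" for z'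
    using assms(5) that unfolding alpha_beta_metric_on_def by blast
  \<comment> \<open>Homogeneity is given for \<open>H\<close> along the fibres; scaling the covector
    by \<open>r\<close> scales both arguments of \<open>h\<close> by \<open>r\<close>.\<close>
  have "h (r * s) (r * t) = r\<^sup>2 * h s t" if r: "r > 0" for r
  proof -
    let ?rz = "(p, \<lambda>c. r *\<^sub>R w c)"
    have "H ?rz = r\<^sup>2 * H z"
      using assms(4) z r unfolding cartan_space_on_def zpw by blast
    moreover have "?rz \<in> region_U M A a b"
      using z r unfolding zpw by (rule region_U_scaleR)
    ultimately show ?thesis
      using Hh[of ?rz] Hh[OF z] r by (simp add: s_def t_def zpw alpha_scaleR beta_scaleR)
  qed
  \<comment> \<open>The smoothness of \<open>h\<close> on a neighbourhood of all values of
    (\<alpha>, \<beta>) supplies a total derivative at this one.\<close>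
  moreover have "(\<lambda>(s, t). h s t) differentiable (at (s, t))"
    using assms(5) z unfolding alpha_beta_metric_on_def s_def t_def
    by (blast intro: smooth_on_imp_differentiable)
  ultimately have euler: "s * d\<alpha> h s t + t * d\<beta> h s t = 2 * h s t"
    using euler_homogeneous[of h s t 2] by simp
  have rho: "rho h s t = t^3 / (2 * s * (t - s)^2)"
    and rho1: "rho1 h s t = (2 * t^3 - 3 * s * t^2) / (2 * (t - s)^2)"
    using assms(6)[OF z s_def t_def] by blast+
  (* At s = 0 the hypothesis on rho only says 0 = 0, but there s * d\<alpha> h s t vanishes anyway. *)
  have "s * d\<alpha> h s t = s * t^3 / (t - s)^2"
    using rho st by (cases "s = 0") (simp_all add: rho_def field_simps)
  moreover have "d\<beta> h s t = (2 * t^3 - 3 * s * t^2) / (t - s)^2"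
    using rho1 st by (simp add: rho1_def divide_simps)
  then have "t * d\<beta> h s t = t * (2 * t^3 - 3 * s * t^2) / (t - s)^2"
    by simp
  ultimately have "2 * h s t = (s * t^3 + t * (2 * t^3 - 3 * s * t^2)) / (t - s)^2"
    using euler by (simp add: add_divide_distrib)
  \<comment> \<open>The numerator contains the factor \<open>t - s\<close>, which is positive on the
    region and cancels one power of the denominator.\<close>
  also have "s * t^3 + t * (2 * t^3 - 3 * s * t^2) = 2 * t^3 * (t - s)"
    by (simp add: algebra_simps power2_eq_square power3_eq_cube)
  also have "2 * t^3 * (t - s) / (t - s)^2 = 2 * (t^3 / (t - s))"
    using st by (simp add: power2_eq_square)
  finally have "h s t = t^3 / (t - s)" by simp
  then show "H z = (beta A b z)^3 / (beta A b z - alpha A a z)"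
    using Hh[OF z] by (simp add: s_def t_def)
qed

end
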